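(* There exist a homeomorphism $f:\mathbb{D}\rightarrow\mathbb{D}$ of the open unit disk $\mathbb{D}=\{z\in\mathbb{C} : |z|<1\}$ and a homeomorphism $g:\mathbb{R}^2\rightarrow\mathbb{R}^2$ such that all of the following hold: $f$ and $g$ are topologically conjugate; $f$ is Li-Yorke chaotic; $f^{-1}$ is not Li-Yorke chaotic; $g$ is not Li-Yorke chaotic; and $g^{-1}$ is not Li-Yorke chaotic.
   Context: Let $(X,d)$ be a metric space and $f:X\rightarrow X$ a continuous map, with $f^n$ denoting the $n$-fold iterate. A pair $\{x,y\}\subseteq X$ is called a Li-Yorke chaotic pair (for $f$) if $$\limsup_{n\rightarrow+\infty}d(f^{n}(x),f^{n}(y))>0 \quad\text{and}\quad \liminf_{n\rightarrow+\infty}d(f^{n}(x),f^{n}(y))=0.$$ The map $f$ is called Li-Yorke chaotic if there exists an uncountable subset $\Gamma\subseteq X$ such that each pair of two distinct points in $\Gamma$ is a Li-Yorke chaotic pair. Continuous maps $f:X\rightarrow X$ and $g:Y\rightarrow Y$ are topologically conjugate if there exists a homeomorphism $h:X\rightarrow Y$ such that $h\circ f=g\circ h$. Both $\mathbb{D}$ and $\mathbb{R}^2$ are equipped with the Euclidean metric $d(z,w)=|z-w|$. *)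

theory Defs
  imports "HOL-Analysis.Analysis"
begin

text \<open>
  A self-map of a subspace \<open>X\<close> of a metric space is represented by a total function on the ambient
  type that maps \<open>X\<close> into \<open>X\<close>; its values outside \<open>X\<close> are irrelevant to the notions below.
  Continuity of the maps is not part of these notions and has to be required separately.
\<close>

text \<open>
  The upper and lower limits are taken in \<^typ>\<open>ereal\<close>, so that an unbounded sequence of distances has
  the upper limit \<open>\<infinity>\<close>.
\<close>

definition li_yorke_pair :: "('a::metric_space \<Rightarrow> 'a) \<Rightarrow> 'a \<Rightarrow> 'a \<Rightarrow> bool" where
  "li_yorke_pair f x y \<longleftrightarrow>
     limsup (\<lambda>n. ereal (dist ((f ^^ n) x) ((f ^^ n) y))) > 0 \<and>
     liminf (\<lambda>n. ereal (dist ((f ^^ n) x) ((f ^^ n) y))) = 0"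

definition li_yorke_chaotic_on :: "'a::metric_space set \<Rightarrow> ('a \<Rightarrow> 'a) \<Rightarrow> bool" where
  "li_yorke_chaotic_on X f \<longleftrightarrow>
     (\<exists>\<Gamma>. \<Gamma> \<subseteq> X \<and> uncountable \<Gamma> \<and> pairwise (li_yorke_pair f) \<Gamma>)"

definition topologically_conjugate ::
  "'a::topological_space set \<Rightarrow> ('a \<Rightarrow> 'a) \<Rightarrow> 'b::topological_space set \<Rightarrow> ('b \<Rightarrow> 'b) \<Rightarrow> bool" where
  "topologically_conjugate X f Y g \<longleftrightarrow>
     (\<exists>h h'. homeomorphism X Y h h' \<and> (\<forall>x\<in>X. h (f x) = g (h x)))"

end

theory Submission
  imports Defs
begin

text \<open>
  Take \<open>g\<close> to be the doubling map of the plane: distinct points move apart under \<open>g\<close>, and all points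
  converge to \<open>0\<close> under \<open>g\<^sup>-\<^sup>1\<close>. Any homeomorphism \<open>P\<close> from the plane onto the disk carries \<open>g\<close> to a map
  \<open>f\<close> of the disk under whose inverse all points converge to \<open>P 0\<close>. So it suffices to choose \<open>P\<close> such that
  \<open>f\<close> is chaotic. We use \<open>P = N \<circ> K\<close>, where \<open>N w = w / (1 + |w|)\<close> and \<open>K (x, y) = (x, a x * y)\<close> with a
  continuous \<open>a > 0\<close> such that \<open>a (2 ^ n)\<close> is \<open>1\<close> for even \<open>n\<close> and \<open>1 / 2 ^ n\<close> for odd \<open>n\<close>. The orbit of
  \<open>(1, y)\<close> under doubling is \<open>(2 ^ n, 2 ^ n * y)\<close>. For even \<open>n\<close> it is fixed by \<open>K\<close>, and its image under
  \<open>N\<close> tends to the direction of \<open>(1, y)\<close>, which determines \<open>y\<close>. For odd \<open>n\<close> it is sent by \<open>K\<close> to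
  \<open>(2 ^ n, y)\<close>, and then \<open>N\<close> makes the points with different \<open>y\<close> asymptotic.
\<close>

section \<open>Criteria for Li-Yorke pairs and for the absence of chaos\<close>

lemma li_yorke_pairI:
  assumes "strict_mono r" "(\<lambda>n. dist ((f ^^ r n) x) ((f ^^ r n) y)) \<longlonglongrightarrow> L" "L > 0"
    and "strict_mono s" "(\<lambda>n. dist ((f ^^ s n) x) ((f ^^ s n) y)) \<longlonglongrightarrow> 0"
  shows "li_yorke_pair f x y"
proof -
  define d where "d = (\<lambda>n. ereal (dist ((f ^^ n) x) ((f ^^ n) y)))"
  have "(d \<circ> r) \<longlonglongrightarrow> ereal L" "(d \<circ> s) \<longlonglongrightarrow> ereal 0"
    using assms(2,5) unfolding d_def o_def lim_ereal by blast+
  then have "limsup (d \<circ> r) = ereal L" "liminf (d \<circ> s) = ereal 0"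
    using lim_imp_Limsup lim_imp_Liminf trivial_limit_sequentially by blast+
  \<comment> \<open>Passing to a subsequence can only lower the upper limit and raise the lower
    limit, so one subsequence of times witnesses each half of the definition.\<close>
  then have "ereal L \<le> limsup d" "liminf d \<le> 0"
    using limsup_subseq_mono[OF assms(1), of d] liminf_subseq_mono[OF assms(4), of d]
    by (simp_all add: zero_ereal_def)
  moreover have "liminf d \<ge> 0"
    by (rule Liminf_bounded) (simp add: d_def)
  moreover have "0 < limsup d"
    using \<open>ereal L \<le> limsup d\<close> \<open>L > 0\<close> by (metis ereal_less(2) less_le_trans)
  ultimately show ?thesis
    unfolding li_yorke_pair_def d_def[symmetric] by (simp add: antisym)
qed

lemma not_li_yorke_pair_asymptotic:
  assumes "(\<lambda>n. dist ((f ^^ n) x) ((f ^^ n) y)) \<longlonglongrightarrow> 0"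
  shows "\<not> li_yorke_pair f x y"
proof -
  have "(\<lambda>n. ereal (dist ((f ^^ n) x) ((f ^^ n) y))) \<longlonglongrightarrow> ereal 0"
    using assms by (simp only: lim_ereal)
  then have "limsup (\<lambda>n. ereal (dist ((f ^^ n) x) ((f ^^ n) y))) = 0"
    by (simp add: lim_imp_Limsup zero_ereal_def)
  then show ?thesis
    by (simp add: li_yorke_pair_def)
qed

lemma not_li_yorke_pair_separated:
  assumes "c > 0" "\<And>n. dist ((f ^^ n) x) ((f ^^ n) y) \<ge> c"
  shows "\<not> li_yorke_pair f x y"
proof -
  have "liminf (\<lambda>n. ereal (dist ((f ^^ n) x) ((f ^^ n) y))) \<ge> ereal c"
    by (rule Liminf_bounded) (simp add: assms)
  then show ?thesis
    using \<open>c > 0\<close> by (auto simp: li_yorke_pair_def)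
qed

lemma not_li_yorke_chaotic_onI:
  assumes "\<And>x y. \<lbrakk>x \<in> X; y \<in> X; x \<noteq> y\<rbrakk> \<Longrightarrow> \<not> li_yorke_pair f x y"
  shows "\<not> li_yorke_chaotic_on X f"
proof
  assume "li_yorke_chaotic_on X f"
  then obtain \<Gamma> where \<Gamma>: "\<Gamma> \<subseteq> X" "uncountable \<Gamma>" "pairwise (li_yorke_pair f) \<Gamma>"
    by (auto simp: li_yorke_chaotic_on_def)
  from \<Gamma>(2) obtain x where "x \<in> \<Gamma>"
    by (metis countable_empty equals0I)
  moreover have "\<not> \<Gamma> \<subseteq> {x}"
    using \<Gamma>(2) countable_subset[of \<Gamma> "{x}"] by auto
  ultimately obtain y where "y \<in> \<Gamma>" "x \<noteq> y"
    by blast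
  then show False
    using \<Gamma> \<open>x \<in> \<Gamma>\<close> assms[of x y] by (auto simp: pairwise_def)
qed

section \<open>Iterates of conjugated maps and of scalings\<close>

lemma funpow_conjugate:
  assumes "\<And>z. q (p z) = z"
  shows "((p \<circ> g \<circ> q) ^^ n) (p z) = p ((g ^^ n) z)"
  by (induction n) (auto simp: assms)

lemma funpow_scaleR: "((*\<^sub>R) c ^^ n) x = c ^ n *\<^sub>R (x :: 'a::real_vector)"
  by (induction n) auto

lemma dist_funpow_scaleR:
  fixes x y :: "'a::real_normed_vector"
  shows "dist (((*\<^sub>R) c ^^ n) x) (((*\<^sub>R) c ^^ n) y) = \<bar>c\<bar> ^ n * dist x y"
  by (simp add: funpow_scaleR dist_norm power_abs flip: scaleR_diff_right)

lemma homeomorphism_scaleR: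
  fixes c :: real
  assumes "c \<noteq> 0"
  shows "homeomorphism UNIV (UNIV :: 'a::real_normed_vector set) ((*\<^sub>R) c) ((*\<^sub>R) (1 / c))"
  by (rule homeomorphismI) (auto intro!: continuous_intros simp: assms)

section \<open>Radial compression of a normed space onto its unit ball\<close>

lemma homeomorphism_ball:
  "homeomorphism UNIV (ball (0 :: 'a::real_normed_vector) 1)
     (\<lambda>w. w /\<^sub>R (1 + norm w)) (\<lambda>z. z /\<^sub>R (1 - norm z))"
proof (rule homeomorphismI)
  have pos: "1 + norm w > 0" for w :: 'a
    by (simp add: add_pos_nonneg)
  have lt: "norm (w /\<^sub>R (1 + norm w)) < 1" for w :: 'a
    using pos[of w] by (simp add: field_simps)
  show "continuous_on UNIV (\<lambda>w :: 'a. w /\<^sub>R (1 + norm w))"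
    using pos by (intro continuous_intros) (auto simp: less_imp_neq[THEN not_sym])
  show "continuous_on (ball (0 :: 'a) 1) (\<lambda>z. z /\<^sub>R (1 - norm z))"
    by (intro continuous_intros) auto
  show "(\<lambda>w :: 'a. w /\<^sub>R (1 + norm w)) ` UNIV \<subseteq> ball 0 1"
    using lt by auto
  show "(w /\<^sub>R (1 + norm w)) /\<^sub>R (1 - norm (w /\<^sub>R (1 + norm w))) = w" for w :: 'a
  proof -
    have "1 - norm (w /\<^sub>R (1 + norm w)) = 1 / (1 + norm w)"
      using pos[of w] by (simp add: field_simps)
    then show ?thesis
      using pos[of w] by simp
  qed
  show "(z /\<^sub>R (1 - norm z)) /\<^sub>R (1 + norm (z /\<^sub>R (1 - norm z))) = z" if "z \<in> ball 0 1" for z :: 'a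
  proof -
    have "1 - norm z > 0"
      using that by simp
    then have "1 + norm (z /\<^sub>R (1 - norm z)) = 1 / (1 - norm z)"
      by (simp add: field_simps)
    then show ?thesis
      using \<open>1 - norm z > 0\<close> by simp
  qed
qed auto

text \<open>The difference splits into a change of the vector and a change of the scalar factor. By
  the reverse triangle inequality and \<open>norm w / (1 + norm w) \<le> 1\<close>, each part is at
  most \<open>dist v w / (1 + norm v)\<close>. Hence points at a fixed distance become close when
  pushed far out.\<close>

lemma dist_normalize_le:
  fixes v w :: "'a::real_normed_vector"
  shows "dist (v /\<^sub>R (1 + norm v)) (w /\<^sub>R (1 + norm w)) \<le> 2 * dist v w / (1 + norm v)"
proof -
  have pos: "1 + norm v > 0" "1 + norm w > 0"
    by (simp_all add: add_pos_nonneg)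
  have coeff: "inverse (1 + norm v) - inverse (1 + norm w)
      = (norm w - norm v) / ((1 + norm v) * (1 + norm w))"
    using pos by (simp add: field_simps)
  have "v /\<^sub>R (1 + norm v) - w /\<^sub>R (1 + norm w)
      = (v - w) /\<^sub>R (1 + norm v) + (inverse (1 + norm v) - inverse (1 + norm w)) *\<^sub>R w"
    by (simp add: algebra_simps)
  also have "norm \<dots> \<le> norm ((v - w) /\<^sub>R (1 + norm v))
      + norm ((inverse (1 + norm v) - inverse (1 + norm w)) *\<^sub>R w)"
    by (rule norm_triangle_ineq)
  also have "norm ((v - w) /\<^sub>R (1 + norm v)) = dist v w / (1 + norm v)"
    using pos by (simp add: dist_norm divide_inverse)
  also have "norm ((inverse (1 + norm v) - inverse (1 + norm w)) *\<^sub>R w)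
      = \<bar>norm w - norm v\<bar> / (1 + norm v) * (norm w / (1 + norm w))"
    using pos unfolding coeff by (simp add: abs_mult)
  also have "\<dots> \<le> dist v w / (1 + norm v) * 1"
  proof (rule mult_mono)
    show "\<bar>norm w - norm v\<bar> / (1 + norm v) \<le> dist v w / (1 + norm v)"
      using pos norm_triangle_ineq3[of w v]
      by (intro divide_right_mono) (auto simp: dist_norm norm_minus_commute)
  qed (use pos in auto)
  finally show ?thesis
    by (simp add: dist_norm)
qed

text \<open>Cancelling \<open>c n\<close> turns the expression into \<open>v\<close> divided by
  \<open>inverse (c n) + norm v\<close>, and this denominator tends to \<open>norm v\<close>. The
  cancellation needs \<open>c n > 0\<close>, which holds eventually.\<close>

lemma normalize_scaleR_tendsto_sgn:
  fixes v :: "'a::real_normed_vector"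
  assumes "v \<noteq> 0" "filterlim c at_top F"
  shows "((\<lambda>n. (c n *\<^sub>R v) /\<^sub>R (1 + norm (c n *\<^sub>R v))) \<longlongrightarrow> sgn v) F"
proof -
  have "((\<lambda>n. inverse (c n)) \<longlongrightarrow> 0) F"
    using assms(2) tendsto_inverse_0_at_top by blast
  then have "((\<lambda>n. v /\<^sub>R (inverse (c n) + norm v)) \<longlongrightarrow> v /\<^sub>R (0 + norm v)) F"
    using assms(1) by (intro tendsto_intros) auto
  then have "((\<lambda>n. v /\<^sub>R (inverse (c n) + norm v)) \<longlongrightarrow> sgn v) F"
    by (simp add: sgn_div_norm)
  moreover have "\<forall>\<^sub>F n in F. c n > 0"
    using assms(2) by (auto simp: filterlim_at_top_dense)
  then have "\<forall>\<^sub>F n in F. v /\<^sub>R (inverse (c n) + norm v) = (c n *\<^sub>R v) /\<^sub>R (1 + norm (c n *\<^sub>R v))"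
  proof eventually_elim
    case (elim n)
    have "1 + norm (c n *\<^sub>R v) = c n * (inverse (c n) + norm v)"
      using elim by (simp add: algebra_simps)
    then show ?case
      using elim by simp
  qed
  ultimately show ?thesis
    by (rule Lim_transform_eventually)
qed

section \<open>Vertical scalings and the oscillating factor\<close>

lemma homeomorphism_vertical_scaling:
  fixes a :: "real \<Rightarrow> real"
  assumes "continuous_on UNIV a" "\<And>x. a x > 0"
  shows "homeomorphism UNIV UNIV
    (\<lambda>z. Complex (Re z) (a (Re z) * Im z)) (\<lambda>z. Complex (Re z) (Im z / a (Re z)))"
proof (rule homeomorphismI)
  have cont: "continuous_on UNIV (\<lambda>z. a (Re z))"
    by (rule continuous_on_compose2[OF assms(1)]) (auto intro: continuous_intros)
  show "continuous_on UNIV (\<lambda>z. Complex (Re z) (a (Re z) * Im z))"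
    unfolding Complex_eq by (intro continuous_intros cont)
  show "continuous_on UNIV (\<lambda>z. Complex (Re z) (Im z / a (Re z)))"
    unfolding Complex_eq
    by (intro continuous_intros cont) (use assms(2) in \<open>auto simp: less_imp_neq[THEN not_sym]\<close>)
qed (use assms(2) in \<open>auto simp: complex_eq_iff less_imp_neq[THEN not_sym]\<close>)

text \<open>A mean of \<open>1\<close> and \<open>1 / m\<close> whose weight \<open>c\<close>
  oscillates in \<open>log 2 m\<close>: at \<open>m = 2 ^ n\<close> it is \<open>1\<close> for even
  \<open>n\<close> and \<open>0\<close> for odd \<open>n\<close>. Cutting off at \<open>1\<close>
  keeps the logarithm and the quotient continuous and makes the factor \<open>1\<close> for all
  \<open>x \<le> 1\<close>.\<close>

definition squeeze :: "real \<Rightarrow> real" where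
  "squeeze x = (let m = max 1 x; c = (cos (pi / 2 * log 2 m))\<^sup>2 in c + (1 - c) / m)"

lemma continuous_squeeze: "continuous_on UNIV squeeze"
proof -
  have "max 1 x \<noteq> (0 :: real)" for x
    by (simp add: max_def)
  then show ?thesis
    unfolding squeeze_def Let_def by (intro continuous_intros) (auto simp: less_max_iff_disj)
qed

lemma squeeze_pos: "squeeze x > 0"
proof -
  define m where "m = max 1 x"
  define c where "c = (cos (pi / 2 * log 2 m))\<^sup>2"
  have "m > 0"
    by (simp add: m_def)
  moreover have "0 \<le> c" "c \<le> 1"
    by (auto simp: c_def abs_square_le_1)
  ultimately have "c + (1 - c) / m > 0"
    by (cases "c = 1") (auto intro: add_nonneg_pos)
  then show ?thesis
    by (simp add: squeeze_def Let_def m_def c_def)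
qed

lemma squeeze_even: "squeeze (2 ^ (2 * k)) = 1"
proof -
  have "log 2 ((2 :: real) ^ (2 * k)) = real (2 * k)"
    by (simp add: log_nat_power del: power_mult)
  moreover have "max 1 ((2 :: real) ^ (2 * k)) = 2 ^ (2 * k)"
    by (simp add: max_def del: power_mult)
  moreover have "(cos (pi / 2 * real (2 * k)))\<^sup>2 = 1"
    using cos_npi2[of k] by (simp add: power_mult[symmetric] mult.commute[of k])
  ultimately show ?thesis
    unfolding squeeze_def Let_def by simp
qed

lemma squeeze_odd: "squeeze (2 ^ Suc (2 * k)) = 1 / 2 ^ Suc (2 * k)"
proof -
  have "log 2 ((2 :: real) ^ Suc (2 * k)) = real (Suc (2 * k))"
    using log_nat_power[of 2 2 "Suc (2 * k)"] by simp
  moreover have "max 1 ((2 :: real) ^ Suc (2 * k)) = 2 ^ Suc (2 * k)"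
    using one_le_power[of "2 :: real" "Suc (2 * k)"] by (simp add: max_def del: power_Suc)
  moreover have "cos (pi / 2 * real (Suc (2 * k))) = 0"
  proof -
    have "pi / 2 * real (Suc (2 * k)) = pi * real k + pi / 2"
      by (simp add: field_simps)
    then show ?thesis
      by (simp only: cos_add sin_npi2 cos_pi_half)
  qed
  ultimately show ?thesis
    unfolding squeeze_def Let_def by (simp del: power_Suc of_nat_Suc)
qed

text \<open>Equal real parts of the normalized vectors force equal norms, and then the imaginary
  parts agree as well.\<close>

lemma sgn_Complex_1_inject: "sgn (Complex 1 y) = sgn (Complex 1 y') \<longleftrightarrow> y = y'"
proof
  define r where "r = (\<lambda>t. norm (Complex 1 t))"
  have "r t > 0" for t
    by (simp add: r_def complex_eq_iff)
  then have r: "r t \<noteq> 0" for t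
    by (metis less_irrefl)
  assume "sgn (Complex 1 y) = sgn (Complex 1 y')"
  then have "Complex 1 y /\<^sub>R r y = Complex 1 y' /\<^sub>R r y'"
    by (simp add: sgn_div_norm r_def)
  then show "y = y'"
    using r by (auto simp: complex_eq_iff)
qed simp

section \<open>The conjugate maps and their dynamics\<close>

theorem theorem3p1:
  shows "\<exists>(f :: complex \<Rightarrow> complex) f_inv (g :: real^2 \<Rightarrow> real^2) g_inv.
    homeomorphism (ball 0 1) (ball 0 1) f f_inv \<and>
    homeomorphism UNIV UNIV g g_inv \<and>
    topologically_conjugate (ball 0 1) f UNIV g \<and>
    li_yorke_chaotic_on (ball 0 1) f \<and>
    \<not> li_yorke_chaotic_on (ball 0 1) f_inv \<and>
    \<not> li_yorke_chaotic_on UNIV g \<and>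
    \<not> li_yorke_chaotic_on UNIV g_inv"
proof -
  define N :: "complex \<Rightarrow> complex" where "N = (\<lambda>w. w /\<^sub>R (1 + norm w))"
  define K where "K = (\<lambda>z. Complex (Re z) (squeeze (Re z) * Im z))"
  define P where "P = N \<circ> K"
  define Q where "Q = (\<lambda>z. Complex (Re z) (Im z / squeeze (Re z))) \<circ> (\<lambda>z. z /\<^sub>R (1 - norm z))"
  define f where "f = P \<circ> (*\<^sub>R) 2 \<circ> Q"
  define f' where "f' = P \<circ> (*\<^sub>R) (1 / 2) \<circ> Q"

  have homP: "homeomorphism UNIV (ball 0 1) P Q"
    unfolding P_def Q_def K_def N_def
    using homeomorphism_vertical_scaling[OF continuous_squeeze squeeze_pos] homeomorphism_ball
    by (rule homeomorphism_compose)
  have QP: "Q (P z) = z" for z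
    using homeomorphism_apply1[OF homP] by simp
  have Pball: "P z \<in> ball 0 1" for z
    using homeomorphism_image1[OF homP] by blast
  have PQ: "P (Q z) = z" if "z \<in> ball 0 1" for z
    using homeomorphism_apply2[OF homP that] .

  have homf: "homeomorphism (ball 0 1) (ball 0 1) f f'"
    using homeomorphism_compose[OF homeomorphism_compose[OF homeomorphism_symD[OF homP]
          homeomorphism_scaleR[of 2]] homP]
    by (simp add: f_def f'_def o_assoc)

  \<comment> \<open>The plane occurs here as two different types. A linear isomorphism between them
    commutes with doubling, so \<open>T \<circ> Q\<close> conjugates \<open>f\<close> to the
    doubling map of \<open>real^2\<close>.\<close>
  have "DIM(complex) = DIM(real^2)"
    by simp
  then obtain T :: "complex \<Rightarrow> real^2" and T' where T: "linear T" "linear T'"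
    "\<And>x. T' (T x) = x" "\<And>y. T (T' y) = y"
    by (rule isomorphisms_UNIV_UNIV) blast
  have homT: "homeomorphism UNIV UNIV T T'"
    by (rule homeomorphismI)
      (auto simp: T linear_continuous_on linear_conv_bounded_linear[symmetric])
  have conj: "topologically_conjugate (ball 0 1) f UNIV ((*\<^sub>R) 2 :: real^2 \<Rightarrow> real^2)"
    unfolding topologically_conjugate_def
    using homeomorphism_compose[OF homeomorphism_symD[OF homP] homT]
    by (intro exI[of _ "T \<circ> Q"] exI[of _ "P \<circ> T'"])
      (simp add: f_def QP linear_scale[OF T(1)])

  have iter: "(f ^^ n) (P z) = P (2 ^ n *\<^sub>R z)" for n z
    unfolding f_def using funpow_conjugate[of Q P n "(*\<^sub>R) 2" z, OF QP] by (simp only: funpow_scaleR)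
  have iter': "(f' ^^ n) (P z) = P ((1 / 2) ^ n *\<^sub>R z)" for n z
    unfolding f'_def using funpow_conjugate[of Q P n "(*\<^sub>R) (1 / 2)" z, OF QP]
    by (simp only: funpow_scaleR)

  have chaotic: "li_yorke_chaotic_on (ball 0 1) f"
    unfolding li_yorke_chaotic_on_def
  proof (intro exI conjI)
    \<comment> \<open>The scrambled set is the image under \<open>P\<close> of the whole vertical
      line with real part \<open>1\<close>.\<close>
    define p where "p = (\<lambda>y. P (Complex 1 y))"
    have "inj p"
      by (rule inj_on_inverseI[where g = "Im \<circ> Q"]) (simp add: p_def QP)
    then show "uncountable (range p)"
      by (simp add: countable_image_inj_eq uncountable_UNIV_real)
    show "range p \<subseteq> ball 0 1"
      using Pball by (auto simp: p_def)
    have "li_yorke_pair f (p y) (p y')" if "y \<noteq> y'" for y y'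
    proof (rule li_yorke_pairI)
      show "strict_mono (\<lambda>k::nat. 2 * k)" "strict_mono (\<lambda>k. Suc (2 * k))"
        by (auto simp: strict_mono_def)
      have orbit: "(f ^^ n) (p t) = N (Complex (2 ^ n) (squeeze (2 ^ n) * (2 ^ n * t)))" for n t
        unfolding p_def iter by (simp add: P_def K_def)
      have even: "(f ^^ (2 * k)) (p t) = N (2 ^ (2 * k) *\<^sub>R Complex 1 t)" for k t
        unfolding orbit squeeze_even by (rule arg_cong[of _ _ N]) (simp add: complex_eq_iff)
      have lim: "filterlim (\<lambda>k. (2 :: real) ^ (2 * k)) at_top sequentially"
        unfolding power_mult
        by (rule filterlim_at_infinity_imp_filterlim_at_top[OF filterlim_realpow_sequentially_gt1]) auto
      have "(\<lambda>k. (f ^^ (2 * k)) (p t)) \<longlonglongrightarrow> sgn (Complex 1 t)" for t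
        unfolding even N_def
        by (rule normalize_scaleR_tendsto_sgn[OF _ lim]) (simp add: complex_eq_iff)
      then show "(\<lambda>k. dist ((f ^^ (2 * k)) (p y)) ((f ^^ (2 * k)) (p y')))
          \<longlonglongrightarrow> dist (sgn (Complex 1 y)) (sgn (Complex 1 y'))"
        by (intro tendsto_dist)
      show "dist (sgn (Complex 1 y)) (sgn (Complex 1 y')) > 0"
        using that by (simp add: sgn_Complex_1_inject)
      \<comment> \<open>The factor at odd times cancels the growth of the imaginary part exactly:
        before \<open>N\<close> is applied, two such points keep the distance of their initial
        heights while their real part grows.\<close>
      have odd: "(f ^^ Suc (2 * k)) (p t) = N (Complex (2 ^ Suc (2 * k)) t)" for k t
        unfolding orbit squeeze_odd by (rule arg_cong[of _ _ N]) (simp add: complex_eq_iff)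
      have bound: "dist ((f ^^ Suc (2 * k)) (p y)) ((f ^^ Suc (2 * k)) (p y'))
          \<le> 2 * \<bar>y - y'\<bar> * (1 / 2) ^ k" for k
      proof -
        \<comment> \<open>The weaker growth rate \<open>2 ^ k\<close> suffices and gives a plain
          geometric bound.\<close>
        have "(2 :: real) ^ k \<le> 2 ^ Suc (2 * k)"
          by (rule power_increasing) auto
        also have "\<dots> \<le> norm (Complex (2 ^ Suc (2 * k)) y)"
          using abs_Re_le_cmod[of "Complex (2 ^ Suc (2 * k)) y"] by simp
        finally have le: "2 ^ k \<le> 1 + norm (Complex (2 ^ Suc (2 * k)) y)"
          by simp
        have "dist (Complex (2 ^ Suc (2 * k)) y) (Complex (2 ^ Suc (2 * k)) y') = \<bar>y - y'\<bar>"
          by (simp add: dist_norm cmod_def)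
        then have "dist ((f ^^ Suc (2 * k)) (p y)) ((f ^^ Suc (2 * k)) (p y'))
            \<le> 2 * \<bar>y - y'\<bar> / (1 + norm (Complex (2 ^ Suc (2 * k)) y))"
          unfolding odd N_def
          using dist_normalize_le[of "Complex (2 ^ Suc (2 * k)) y" "Complex (2 ^ Suc (2 * k)) y'"]
          by (simp only:)
        also have "\<dots> \<le> 2 * \<bar>y - y'\<bar> / 2 ^ k"
          using le by (intro divide_left_mono) (auto intro!: mult_pos_pos add_pos_nonneg)
        finally show ?thesis
          by (simp add: power_divide)
      qed
      have "(\<lambda>k. 2 * \<bar>y - y'\<bar> * (1 / 2) ^ k) \<longlonglongrightarrow> 0"
        by (intro tendsto_mult_right_zero LIMSEQ_power_zero) simp
      then show "(\<lambda>k. dist ((f ^^ Suc (2 * k)) (p y)) ((f ^^ Suc (2 * k)) (p y'))) \<longlonglongrightarrow> 0"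
        by (rule Lim_null_comparison[rotated])
          (simp only: real_norm_def abs_of_nonneg[OF zero_le_dist] bound eventually_True)
    qed
    then show "pairwise (li_yorke_pair f) (range p)"
      by (rule pairwise_imageI)
  qed

  have not_f': "\<not> li_yorke_chaotic_on (ball 0 1) f'"
  proof (rule not_li_yorke_chaotic_onI, rule not_li_yorke_pair_asymptotic)
    fix x y :: complex
    assume "x \<in> ball 0 1" "y \<in> ball 0 1"
    \<comment> \<open>Halving draws \<open>Q z\<close> to the origin, and continuity of
      \<open>P\<close> at \<open>0\<close> carries this limit to the disk, so any two orbits are
      asymptotic.\<close>
    have lim: "(\<lambda>n. (f' ^^ n) z) \<longlonglongrightarrow> P 0" if "z \<in> ball 0 1" for z
    proof -
      have "(f' ^^ n) z = P ((1 / 2) ^ n *\<^sub>R Q z)" for n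
        using iter'[of n "Q z"] PQ[OF that] by simp
      moreover have "(\<lambda>n. (1 / 2) ^ n *\<^sub>R Q z) \<longlonglongrightarrow> 0 *\<^sub>R Q z"
        by (intro tendsto_intros LIMSEQ_power_zero) simp
      moreover have "isCont P 0"
        using homeomorphism_cont1[OF homP] by (simp add: continuous_on_eq_continuous_at)
      ultimately show ?thesis
        using isCont_tendsto_compose[of 0 P] by simp
    qed
    show "(\<lambda>n. dist ((f' ^^ n) x) ((f' ^^ n) y)) \<longlonglongrightarrow> 0"
      using tendsto_dist[OF lim[OF \<open>x \<in> ball 0 1\<close>] lim[OF \<open>y \<in> ball 0 1\<close>]] by (simp only: dist_self)
  qed

  have not_g: "\<not> li_yorke_chaotic_on UNIV ((*\<^sub>R) 2 :: real^2 \<Rightarrow> real^2)"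
  proof (rule not_li_yorke_chaotic_onI, rule not_li_yorke_pair_separated)
    fix x y :: "real^2" and n
    assume "x \<noteq> y"
    then show "dist x y > 0"
      by simp
    \<comment> \<open>Doubling never shrinks distances, so the initial distance serves as the
      separation constant.\<close>
    have "1 * dist x y \<le> 2 ^ n * dist x y"
      by (intro mult_right_mono) auto
    then show "dist x y \<le> dist (((*\<^sub>R) 2 ^^ n) x) (((*\<^sub>R) 2 ^^ n) y)"
      by (simp add: dist_funpow_scaleR)
  qed

  have not_g': "\<not> li_yorke_chaotic_on UNIV ((*\<^sub>R) (1 / 2) :: real^2 \<Rightarrow> real^2)"
  proof (rule not_li_yorke_chaotic_onI, rule not_li_yorke_pair_asymptotic)
    fix x y :: "real^2"
    have "(\<lambda>n. (1 / 2) ^ n * dist x y) \<longlonglongrightarrow> 0"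
      by (intro tendsto_mult_left_zero LIMSEQ_power_zero) simp
    then show "(\<lambda>n. dist (((*\<^sub>R) (1 / 2) ^^ n) x) (((*\<^sub>R) (1 / 2) ^^ n) y)) \<longlonglongrightarrow> 0"
      by (simp add: dist_funpow_scaleR)
  qed

  have "homeomorphism UNIV UNIV ((*\<^sub>R) 2 :: real^2 \<Rightarrow> real^2) ((*\<^sub>R) (1 / 2))"
    by (rule homeomorphism_scaleR) simp
  with homf conj chaotic not_f' not_g not_g' show ?thesis
    by blast
qed

end
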